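(* Let $S$ be a fixed scoring model. There is a polynomial-time algorithm that, given a single round robin competition with scoring model $S$ (a set of teams $V$ and the fair outcome of every game), a coalition $C\subseteq V$ and a team $v_l\in V$, decides whether there is a destructive manipulation by $C$ against $v_l$, i.e. a manipulation after which $v_l$ loses the competition.
   Context: In a single round robin competition each pair of distinct teams plays exactly one game. A scoring model $S$ is a finite set of pairs of non-negative numbers giving the possible outcomes of a game: outcome $(a,b)\in S$ gives $a$ points to the first team of the game and $b$ points to the second (each game has a designated first and second team). The input gives, for each ordered pair of distinct teams, the number $w_{ij}$ of points $v_i$ earns against $v_j$ in a fair game, so that $(w_{ij},w_{ji})\in S$ when $v_i$ is the first team. Manipulations by a coalition $C$: the outcome of a game between two non-members of $C$ is fixed to its fair outcome. A game between two members of $C$ may be given any outcome in $S$. A game between a member of $C$ and a non-member may be given any outcome in $S$ in which the member earns no more points, and the non-member no fewer points, than in the fair outcome. A team's score is its total number of points over all its games; $v_l$ loses if some other team has a strictly larger score than $v_l$. *)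

theory Defs
  imports Complex_Main "HOL-Library.Log_Nat" "HOL-Computational_Algebra.Polynomial"
begin

section \<open>Random access machines with logarithmic cost\<close>

text \<open>
  The machine has registers and a memory, both holding natural numbers. Registers are named by the
  program text, so a program uses only finitely many of them; the memory is accessed
  only indirectly, at an address held in a register. The only arithmetic is addition and truncated
  subtraction, and an instruction is charged the bit lengths of the numbers it handles (the
  logarithmic cost criterion of Cook and Reckhow), so that polynomial time here coincides with
  polynomial time on Turing machines.
\<close>

datatype com =
    Skip
  | Const nat nat           \<comment> \<open>\<open>R i := c\<close>\<close>
  | Add nat nat nat         \<comment> \<open>\<open>R i := R j + R k\<close>\<close>
  | Sub nat nat nat         \<comment> \<open>\<open>R i := R j - R k\<close>, truncated at 0\<close>
  | Load nat nat            \<comment> \<open>\<open>R i := M (R j)\<close>\<close>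
  | Store nat nat           \<comment> \<open>\<open>M (R i) := R j\<close>\<close>
  | Seq com com
  | If nat com com          \<comment> \<open>tests \<open>R i \<noteq> 0\<close>\<close>
  | While nat com           \<comment> \<open>tests \<open>R i \<noteq> 0\<close>\<close>

type_synonym state = "(nat \<Rightarrow> nat) \<times> (nat \<Rightarrow> nat)"  \<comment> \<open>registers and memory\<close>

abbreviation bits :: "nat \<Rightarrow> nat" where
  "bits x \<equiv> floorlog 2 x"

text \<open>\<open>exec c s t s'\<close>: started in state \<open>s\<close>, program \<open>c\<close> halts in state \<open>s'\<close> with total cost \<open>t\<close>.\<close>

inductive exec :: "com \<Rightarrow> state \<Rightarrow> nat \<Rightarrow> state \<Rightarrow> bool" where
  Skip: "exec Skip s 1 s"
| Const: "exec (Const i c) (R, M) (1 + bits c) (R(i := c), M)"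
| Add: "exec (Add i j k) (R, M) (1 + bits (R j) + bits (R k)) (R(i := R j + R k), M)"
| Sub: "exec (Sub i j k) (R, M) (1 + bits (R j) + bits (R k)) (R(i := R j - R k), M)"
| Load: "exec (Load i j) (R, M) (1 + bits (R j) + bits (M (R j))) (R(i := M (R j)), M)"
| Store: "exec (Store i j) (R, M) (1 + bits (R i) + bits (R j)) (R, M(R i := R j))"
| Seq: "exec c1 s t1 s' \<Longrightarrow> exec c2 s' t2 s'' \<Longrightarrow> exec (Seq c1 c2) s (t1 + t2) s''"
| IfTrue: "R i \<noteq> 0 \<Longrightarrow> exec c1 (R, M) t s' \<Longrightarrow> exec (If i c1 c2) (R, M) (1 + bits (R i) + t) s'"
| IfFalse: "R i = 0 \<Longrightarrow> exec c2 (R, M) t s' \<Longrightarrow> exec (If i c1 c2) (R, M) (1 + bits (R i) + t) s'"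
| WhileTrue: "R i \<noteq> 0 \<Longrightarrow> exec c (R, M) t1 s' \<Longrightarrow> exec (While i c) s' t2 s'' \<Longrightarrow>
    exec (While i c) (R, M) (1 + bits (R i) + t1 + t2) s''"
| WhileFalse: "R i = 0 \<Longrightarrow> exec (While i c) (R, M) (1 + bits (R i)) (R, M)"

lemma exec_deterministic:
  "exec c s t s' \<Longrightarrow> exec c s u s'' \<Longrightarrow> t = u \<and> s' = s''"
proof (induction arbitrary: u s'' rule: exec.induct)
  case Skip
  then show ?case by (cases rule: exec.cases) simp_all
next
  case Const
  then show ?case by (cases rule: exec.cases) simp_all
next
  case Add
  then show ?case by (cases rule: exec.cases) simp_all
next
  case Sub
  then show ?case by (cases rule: exec.cases) simp_all
next
  case Load
  then show ?case by (cases rule: exec.cases) simp_all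
next
  case Store
  then show ?case by (cases rule: exec.cases) simp_all
next
  case (Seq c1 s t1 s1 c2 t2 s2)
  from Seq.prems show ?case by cases (blast dest: Seq.IH)
next
  case (IfTrue R i c1 M t s' c2)
  from IfTrue.prems IfTrue.hyps(1) show ?case
    by cases (blast dest: IfTrue.IH, simp)
next
  case (IfFalse R i c2 M t s' c1)
  from IfFalse.prems IfFalse.hyps(1) show ?case
    by cases (simp, blast dest: IfFalse.IH)
next
  case (WhileTrue R i c M t1 s1 t2 s2)
  note hyp = WhileTrue.hyps(1) and IH1 = WhileTrue.IH(1) and IH2 = WhileTrue.IH(2)
  from WhileTrue.prems show ?case
  proof cases
    case (WhileTrue v1 s' v2)
    have "t1 = v1 \<and> s1 = s'" by (rule IH1) fact
    moreover from this WhileTrue have "t2 = v2 \<and> s2 = s''" by (intro IH2) simp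
    ultimately show ?thesis using WhileTrue(1) by simp
  next
    case WhileFalse
    with hyp show ?thesis by simp
  qed
next
  case (WhileFalse R i c M)
  from WhileFalse.prems WhileFalse.hyps show ?case by cases simp_all
qed

text \<open>The input, a list of numbers, is stored in the memory from address 0 on.\<close>

definition init :: "nat list \<Rightarrow> state" where
  "init xs = ((\<lambda>_. 0), (\<lambda>a. if a < length xs then xs ! a else 0))"

definition input_size :: "nat list \<Rightarrow> nat" where
  "input_size xs = (\<Sum>x\<leftarrow>xs. 1 + bits x)"

text \<open>
  The decision problem \<open>P\<close> on the set \<open>I\<close> of instances, encoded by \<open>enc\<close>, has a polynomial-time
  algorithm; the answer is read off register 0.
\<close>

definition polytime_decidable :: "'i set \<Rightarrow> ('i \<Rightarrow> nat list) \<Rightarrow> ('i \<Rightarrow> bool) \<Rightarrow> bool" where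
  "polytime_decidable I enc P \<longleftrightarrow>
     (\<exists>(c :: com) (p :: nat poly). \<forall>x\<in>I. \<exists>t R M.
        exec c (init (enc x)) t (R, M) \<and>
        t \<le> poly p (input_size (enc x)) \<and>
        (R 0 \<noteq> 0 \<longleftrightarrow> P x))"

section \<open>Round robin competitions\<close>

text \<open>
  The numbers of a scoring model are rational, so that they can be written down and
  sums of them compared by a machine.
\<close>

type_synonym scoring_model = "(rat \<times> rat) set"

definition scoring_model :: "scoring_model \<Rightarrow> bool" where
  "scoring_model S \<longleftrightarrow> finite S \<and> (\<forall>(a, b)\<in>S. 0 \<le> a \<and> 0 \<le> b)"

text \<open>
  \<open>first K i j\<close> says that \<open>i\<close> is the designated first team of the game between \<open>i\<close> and \<open>j\<close>;
  \<open>fair K i j\<close> is the number of points \<open>i\<close> earns against \<open>j\<close> in a fair game. Both are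
  meaningful only for distinct teams.
\<close>

record 'a competition =
  teams :: "'a set"
  first :: "'a \<Rightarrow> 'a \<Rightarrow> bool"
  fair :: "'a \<Rightarrow> 'a \<Rightarrow> rat"

definition round_robin :: "scoring_model \<Rightarrow> 'a competition \<Rightarrow> bool" where
  "round_robin S K \<longleftrightarrow> finite (teams K) \<and>
     (\<forall>i\<in>teams K. \<forall>j\<in>teams K. i \<noteq> j \<longrightarrow>
        (first K i j \<longleftrightarrow> \<not> first K j i) \<and>
        (first K i j \<longrightarrow> (fair K i j, fair K j i) \<in> S))"

text \<open>\<open>u i j\<close> is the number of points \<open>i\<close> earns against \<open>j\<close> after the manipulation.\<close>

definition manipulation ::
  "scoring_model \<Rightarrow> 'a competition \<Rightarrow> 'a set \<Rightarrow> ('a \<Rightarrow> 'a \<Rightarrow> rat) \<Rightarrow> bool" where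
  "manipulation S K C u \<longleftrightarrow>
     (\<forall>i\<in>teams K. \<forall>j\<in>teams K. i \<noteq> j \<longrightarrow>
        (first K i j \<longrightarrow> (u i j, u j i) \<in> S) \<and>
        (i \<notin> C \<and> j \<notin> C \<longrightarrow> u i j = fair K i j) \<and>
        (i \<in> C \<and> j \<notin> C \<longrightarrow> u i j \<le> fair K i j \<and> fair K j i \<le> u j i))"

definition score :: "'a competition \<Rightarrow> ('a \<Rightarrow> 'a \<Rightarrow> rat) \<Rightarrow> 'a \<Rightarrow> rat" where
  "score K u i = (\<Sum>j\<in>teams K - {i}. u i j)"

definition loses :: "'a competition \<Rightarrow> ('a \<Rightarrow> 'a \<Rightarrow> rat) \<Rightarrow> 'a \<Rightarrow> bool" where
  "loses K u l \<longleftrightarrow> (\<exists>i\<in>teams K. i \<noteq> l \<and> score K u l < score K u i)"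

definition destructive_manipulation ::
  "scoring_model \<Rightarrow> 'a competition \<Rightarrow> 'a set \<Rightarrow> 'a \<Rightarrow> bool" where
  "destructive_manipulation S K C l \<longleftrightarrow> (\<exists>u. manipulation S K C u \<and> loses K u l)"

section \<open>Instances of the decision problem and their encoding\<close>

text \<open>As inputs to an algorithm, the teams are numbered from 0.\<close>

type_synonym instance_data = "nat competition \<times> nat set \<times> nat"

definition instances :: "scoring_model \<Rightarrow> instance_data set" where
  "instances S = {(K, C, l). round_robin S K \<and> teams K = {..<card (teams K)} \<and>
                    C \<subseteq> teams K \<and> l \<in> teams K}"

text \<open>Numerator and denominator of a non-negative rational in lowest terms.\<close>

definition encode_rat :: "rat \<Rightarrow> nat list" where
  "encode_rat q = [nat (fst (quotient_of q)), nat (snd (quotient_of q))]"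

text \<open>
  The encoding lists the number of teams, the team \<open>l\<close>, the characteristic vector of the coalition,
  and, in row-major order, a three-number entry for every ordered pair of teams (zeros on
  the diagonal).
\<close>

definition encode_game :: "nat competition \<Rightarrow> nat \<Rightarrow> nat \<Rightarrow> nat list" where
  "encode_game K i j =
     (if i = j then [0, 0, 0] else of_bool (first K i j) # encode_rat (fair K i j))"

fun encode :: "instance_data \<Rightarrow> nat list" where
  "encode (K, C, l) = (let n = card (teams K) in
     [n, l] @ map (\<lambda>i. of_bool (i \<in> C)) [0..<n] @
     concat (map (\<lambda>i. concat (map (encode_game K i) [0..<n])) [0..<n]))"

end

theory Submission
  imports Defs
begin

text \<open>
  The team \<open>l\<close> can be made to lose iff some rival \<open>i\<close> can be made to overtake it. For a fixed \<open>i\<close> the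
  outcomes of different games are chosen independently, so the score of \<open>i\<close> minus the score of \<open>l\<close>
  is maximised game by game: \<open>i\<close> earns as much as possible and \<open>l\<close> as little as possible against
  the others, and the lead of \<open>i\<close> in the game against \<open>l\<close> is as large as possible. Since \<open>S\<close> is
  fixed, the optimal outcome of a game is a function on a finite set of input patterns and can be
  hardwired as a table, with all points scaled to integers by a common denominator. The decision then
  is the value of one arithmetic expression with bounded sums over the memory, and every such
  expression can be evaluated in time polynomial in the numbers in the memory; these are
  polynomial in the size of the input, as points come from \<open>S\<close>.
\<close>

section \<open>Compiling arithmetic expressions\<close>

datatype exp =
    Num nat
  | Var nat
  | Plus exp exp
  | Minus exp exp
  | Mem exp
  | Sum nat exp exp

primrec eval :: "(nat \<Rightarrow> nat) \<Rightarrow> (nat \<Rightarrow> nat) \<Rightarrow> exp \<Rightarrow> nat" where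
  "eval M R (Num c) = c"
| "eval M R (Var x) = R x"
| "eval M R (Plus a b) = eval M R a + eval M R b"
| "eval M R (Minus a b) = eval M R a - eval M R b"
| "eval M R (Mem a) = M (eval M R a)"
| "eval M R (Sum x a b) = (\<Sum>k<eval M R a. eval M (R(x := k)) b)"

text \<open>Variables are registers, and compiled code overwrites the bound ones as well. Including
  them lets \<open>vars e \<subseteq> {..<d}\<close> keep every variable clear of the scratch
  registers from \<open>d\<close> on.\<close>

primrec vars :: "exp \<Rightarrow> nat set" where
  "vars (Num c) = {}"
| "vars (Var x) = {x}"
| "vars (Plus a b) = vars a \<union> vars b"
| "vars (Minus a b) = vars a \<union> vars b"
| "vars (Mem a) = vars a"
| "vars (Sum x a b) = insert x (vars a \<union> vars b)"

lemma eval_cong: "(\<And>x. x \<in> vars e \<Longrightarrow> R x = R' x) \<Longrightarrow> eval M R e = eval M R' e"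
proof (induction e arbitrary: R R')
  case (Sum x a b)
  have "eval M R a = eval M R' a" by (rule Sum.IH) (simp add: Sum.prems)
  moreover have "eval M (R(x := k)) b = eval M (R'(x := k)) b" for k
    by (rule Sum.IH) (simp add: Sum.prems)
  ultimately show ?case by simp
qed (simp, simp, metis UnCI eval.simps(3) vars.simps(3), metis UnCI eval.simps(4) vars.simps(4),
    metis eval.simps(5) vars.simps(5))

notation Seq (infixr ";;" 60)

text \<open>
  The loop of a sum counts its variable down to 0; the zero then serves to copy registers.
\<close>

primrec comp :: "exp \<Rightarrow> nat \<Rightarrow> com" where
  "comp (Num c) d = Const d c"
| "comp (Var x) d = Const d 0 ;; Add d x d"
| "comp (Plus a b) d = comp a d ;; comp b (d + 1) ;; Add d d (d + 1)"
| "comp (Minus a b) d = comp a d ;; comp b (d + 1) ;; Sub d d (d + 1)"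
| "comp (Mem a) d = comp a d ;; Load d d"
| "comp (Sum x a b) d =
     comp a d ;; Const (d + 2) 0 ;; Add (d + 1) x (d + 2) ;; Add x d (d + 2) ;;
     While x (Const (d + 3) 1 ;; Sub x x (d + 3) ;; comp b (d + 3) ;; Add (d + 2) (d + 2) (d + 3)) ;;
     Add d (d + 2) x ;; Add x (d + 1) x"

text \<open>The argument is a common bound \<open>X\<close> on variables and memory. A bound
  variable stays below the value of \<open>a\<close>, so the body of a sum is bounded at
  \<open>X\<close> plus the bound of \<open>a\<close>.\<close>

primrec value_bound :: "exp \<Rightarrow> nat poly" where
  "value_bound (Num c) = [:c:]"
| "value_bound (Var x) = [:0, 1:]"
| "value_bound (Plus a b) = value_bound a + value_bound b"
| "value_bound (Minus a b) = value_bound a"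
| "value_bound (Mem a) = [:0, 1:]"
| "value_bound (Sum x a b) = value_bound a * pcompose (value_bound b) ([:0, 1:] + value_bound a)"

text \<open>Bit lengths are estimated by the numbers themselves.\<close>

primrec cost_bound :: "exp \<Rightarrow> nat poly" where
  "cost_bound (Num c) = [:1 + c:]"
| "cost_bound (Var x) = [:2, 1:]"
| "cost_bound (Plus a b) = cost_bound a + cost_bound b + value_bound a + value_bound b + 1"
| "cost_bound (Minus a b) = cost_bound a + cost_bound b + value_bound a + value_bound b + 1"
| "cost_bound (Mem a) = cost_bound a + value_bound a + [:1, 1:]"
| "cost_bound (Sum x a b) = cost_bound a +
     value_bound a * ([:6:] + value_bound a + value_bound a +
       pcompose (cost_bound b + value_bound b) ([:0, 1:] + value_bound a) + value_bound (Sum x a b)) +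
     value_bound a + value_bound (Sum x a b) + [:6, 2:]"

section \<open>Bounds on values and running times\<close>

lemma bits_le: "bits x \<le> x"
  by (rule floorlog_leI) simp_all

lemma eval_le_value_bound:
  assumes "\<And>x. x \<in> vars e \<Longrightarrow> R x \<le> X" and "\<And>a. M a \<le> X"
  shows "eval M R e \<le> poly (value_bound e) X"
  using assms
proof (induction e arbitrary: R X)
  case (Sum x a b)
  let ?A = "poly (value_bound a) X"
  have a: "eval M R a \<le> ?A" by (rule Sum.IH) (simp_all add: Sum.prems)
  have b: "eval M (R(x := k)) b \<le> poly (value_bound b) (X + ?A)" if "k < eval M R a" for k
  proof (rule Sum.IH)
    show "M i \<le> X + ?A" for i using Sum.prems(2)[of i] by simp
    show "(R(x := k)) y \<le> X + ?A" if "y \<in> vars b" for y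
      using \<open>k < eval M R a\<close> a that Sum.prems(1)[of y] by auto
  qed
  have "eval M R (Sum x a b) \<le> eval M R a * poly (value_bound b) (X + ?A)"
    using sum_bounded_above[OF b, of "{..<eval M R a}" "\<lambda>k. k"] by simp
  also have "\<dots> \<le> ?A * poly (value_bound b) (X + ?A)" using a by simp
  finally show ?case by (simp add: poly_pcompose add.commute)
next
  case (Minus a b)
  have "eval M R a \<le> poly (value_bound a) X" by (rule Minus.IH) (simp_all add: Minus.prems)
  then show ?case by simp
qed (simp_all add: add_mono)

text \<open>Memory is never written to, so it is a fixed parameter here.\<close>

definition runs :: "(nat \<Rightarrow> nat) \<Rightarrow> com \<Rightarrow> (nat \<Rightarrow> nat) \<Rightarrow> nat \<Rightarrow> (nat \<Rightarrow> nat) \<Rightarrow> bool" where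
  "runs M c R T R' \<longleftrightarrow> (\<exists>t\<le>T. exec c (R, M) t (R', M))"

lemma runsI: "exec c (R, M) t (R', M) \<Longrightarrow> t \<le> T \<Longrightarrow> runs M c R T R'"
  unfolding runs_def by blast

lemma runs_Const: "runs M (Const i c) R (1 + c) (R(i := c))"
  by (intro runsI[OF exec.Const] add_mono order_refl bits_le)

lemma runs_Add: "runs M (Add i j k) R (1 + R j + R k) (R(i := R j + R k))"
  by (intro runsI[OF exec.Add] add_mono order_refl bits_le)

lemma runs_Sub: "runs M (Sub i j k) R (1 + R j + R k) (R(i := R j - R k))"
  by (intro runsI[OF exec.Sub] add_mono order_refl bits_le)

lemma runs_Load: "runs M (Load i j) R (1 + R j + M (R j)) (R(i := M (R j)))"
  by (intro runsI[OF exec.Load] add_mono order_refl bits_le)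

lemma runs_Seq:
  assumes "runs M c1 R T1 R1" "runs M c2 R1 T2 R2"
  shows "runs M (c1 ;; c2) R (T1 + T2) R2"
  using assms unfolding runs_def by (blast intro: exec.Seq add_mono)

lemma runs_While_True:
  assumes "R i \<noteq> 0" "runs M c R T1 R1" "runs M (While i c) R1 T2 R2"
  shows "runs M (While i c) R (1 + R i + T1 + T2) R2"
proof -
  from assms obtain t1 t2 where "t1 \<le> T1" "exec c (R, M) t1 (R1, M)"
      "t2 \<le> T2" "exec (While i c) (R1, M) t2 (R2, M)"
    unfolding runs_def by blast
  with assms(1) show ?thesis
    by (intro runsI[OF exec.WhileTrue] add_mono order_refl bits_le)
qed

lemma runs_While_False:
  assumes "R i = 0"
  shows "runs M (While i c) R 1 R"
  unfolding runs_def using exec.WhileFalse[of R i c M] assms by (auto simp: floorlog_def)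

lemma runs_mono: "runs M c R T R1 \<Longrightarrow> T \<le> T' \<Longrightarrow> R1 = R2 \<Longrightarrow> runs M c R T' R2"
  unfolding runs_def using order_trans by blast

text \<open>\<open>s\<close> is the accumulator; the body leaves the summand in register \<open>s + 1\<close>.\<close>

lemma runs_sum_loop:
  assumes body: "\<And>k R. k < m \<Longrightarrow> (\<And>r. r < s \<Longrightarrow> r \<noteq> x \<Longrightarrow> R r = R0 r) \<Longrightarrow> R x = k \<Longrightarrow>
      \<exists>R'. runs M c R T R' \<and> R' (s + 1) = f k \<and> (\<forall>r\<le>s. R' r = R r)"
    and f: "\<And>k. k < m \<Longrightarrow> f k \<le> B"
    and x: "x < s"
    and R: "\<And>r. r < s \<Longrightarrow> r \<noteq> x \<Longrightarrow> R r = R0 r" "R x = i" "i \<le> m" "R s \<le> (m - i) * B"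
  shows "\<exists>R'. runs M (While x (Const (s + 1) 1 ;; Sub x x (s + 1) ;; c ;; Add s s (s + 1)))
      R (i * (6 + m + m + T + B + m * B) + 1) R' \<and> R' x = 0 \<and> R' s = R s + (\<Sum>k<i. f k) \<and>
      (\<forall>r<s. r \<noteq> x \<longrightarrow> R' r = R0 r)"
  using R
\<comment> \<open>The counter \<open>i\<close> is the number of summands still to be added, those
  with index below \<open>i\<close>; the bound \<open>(m - i) * B\<close> on the accumulator
  accounts for the others.\<close>
proof (induction i arbitrary: R)
  case 0
  then show ?case using runs_While_False by (intro exI[of _ R]) simp
next
  case (Suc i)
  \<comment> \<open>The decrement precedes the body, so a counter of \<open>Suc i\<close> yields the
    summand with index \<open>i\<close>.\<close>
  let ?R2 = "R(s + 1 := 1, x := i)"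
  from x Suc.prems have "\<exists>R'. runs M c ?R2 T R' \<and> R' (s + 1) = f i \<and> (\<forall>r\<le>s. R' r = ?R2 r)"
    by (intro body) auto
  then obtain R3 where R3: "runs M c ?R2 T R3" "R3 (s + 1) = f i" "\<And>r. r \<le> s \<Longrightarrow> R3 r = ?R2 r"
    by blast
  let ?R4 = "R3(s := R s + f i)"
  have s: "R3 s = R s" using R3(3)[of s] x by simp
  have fi: "f i \<le> B" using f Suc.prems by simp
  have acc: "R s + f i \<le> (m - i) * B"
  proof -
    have "R s + f i \<le> (m - Suc i) * B + B" using Suc.prems fi by simp
    also have "\<dots> = Suc (m - Suc i) * B" by simp
    also have "Suc (m - Suc i) = m - i" using Suc.prems by simp
    finally show ?thesis .
  qed
  have 1: "runs M (Const (s + 1) 1) R 2 (R(s + 1 := 1))"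
    using runs_Const[of M "s + 1" 1 R] by (simp only: one_add_one)
  have 2: "runs M (Sub x x (s + 1)) (R(s + 1 := 1)) (2 + Suc i) ?R2"
    using runs_Sub[of M x x "s + 1" "R(s + 1 := 1)"] Suc.prems x by simp
  have 4: "runs M (Add s s (s + 1)) R3 (1 + R s + f i) ?R4"
    using runs_Add[of M s s "s + 1" R3] R3(2) s by simp
  have "\<exists>R'. runs M (While x (Const (s + 1) 1 ;; Sub x x (s + 1) ;; c ;; Add s s (s + 1)))
      ?R4 (i * (6 + m + m + T + B + m * B) + 1) R' \<and> R' x = 0 \<and> R' s = ?R4 s + (\<Sum>k<i. f k) \<and>
      (\<forall>r<s. r \<noteq> x \<longrightarrow> R' r = R0 r)"
    using x R3(3) Suc.prems acc by (intro Suc.IH) auto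
  then obtain R' where R': "runs M (While x (Const (s + 1) 1 ;; Sub x x (s + 1) ;; c ;; Add s s (s + 1)))
      ?R4 (i * (6 + m + m + T + B + m * B) + 1) R'" "R' x = 0" "R' s = ?R4 s + (\<Sum>k<i. f k)"
      "\<forall>r<s. r \<noteq> x \<longrightarrow> R' r = R0 r" by blast
  \<comment> \<open>A uniform cost per round: \<open>m * B\<close> pays for reading the accumulator,
    and the two \<open>m\<close> pay for reading the counter in the test and in the
    decrement.\<close>
  have "R s \<le> m * B" using Suc.prems(4) by (meson diff_le_self le_trans mult_le_mono1)
  then have "1 + R x + (2 + (2 + Suc i + (T + (1 + R s + f i)))) \<le> 6 + m + m + T + B + m * B"
    using Suc.prems(2,3) fi by linarith
  then have le: "1 + R x + (2 + (2 + Suc i + (T + (1 + R s + f i)))) +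
      (i * (6 + m + m + T + B + m * B) + 1) \<le> Suc i * (6 + m + m + T + B + m * B) + 1"
    unfolding mult_Suc by linarith
  have "R x \<noteq> 0" using Suc.prems(2) by simp
  from runs_mono[OF runs_While_True[OF this runs_Seq[OF 1 runs_Seq[OF 2 runs_Seq[OF R3(1) 4]]] R'(1)] le refl] R'(2-4)
  show ?case by (intro exI[of _ R'] conjI) (simp_all only: sum.lessThan_Suc fun_upd_same ac_simps)
qed

text \<open>By induction on \<open>e\<close>: the scratch space of a subexpression starts above the
  registers still in use, so earlier results survive, and a sum saves and restores the outer value
  of its variable. \<open>X\<close> is generalised because the body of a sum runs under a larger
  bound.\<close>

lemma runs_comp:
  assumes "vars e \<subseteq> {..<d}" and "\<And>x. x \<in> vars e \<Longrightarrow> R x \<le> X" and "\<And>a. M a \<le> X"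
  shows "\<exists>R'. runs M (comp e d) R (poly (cost_bound e) X) R' \<and> R' d = eval M R e \<and>
    (\<forall>r<d. R' r = R r)"
  using assms
proof (induction e arbitrary: R X d)
  case (Num c)
  have "runs M (comp (Num c) d) R (poly (cost_bound (Num c)) X) (R(d := c))"
    unfolding comp.simps by (rule runs_mono[OF runs_Const]) simp_all
  moreover have "\<forall>r<d. (R(d := c)) r = R r" by simp
  moreover have "(R(d := c)) d = eval M R (Num c)" by simp
  ultimately show ?case by blast
next
  case (Var x)
  have "runs M (comp (Var x) d) R (poly (cost_bound (Var x)) X) (R(d := R x))"
    unfolding comp.simps
    by (rule runs_mono[OF runs_Seq[OF runs_Const runs_Add]]) (use Var.prems in auto)
  moreover have "\<forall>r<d. (R(d := R x)) r = R r" by simp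
  moreover have "(R(d := R x)) d = eval M R (Var x)" by simp
  ultimately show ?case by blast
next
  case (Plus a b)
  let ?A = "poly (value_bound a) X" and ?B = "poly (value_bound b) X"
  have "\<exists>R'. runs M (comp a d) R (poly (cost_bound a) X) R' \<and> R' d = eval M R a \<and>
      (\<forall>r<d. R' r = R r)"
    using Plus.prems by (intro Plus.IH) auto
  then obtain R1 where R1: "runs M (comp a d) R (poly (cost_bound a) X) R1"
      "R1 d = eval M R a" "\<forall>r<d. R1 r = R r" by blast
  have "\<exists>R'. runs M (comp b (d + 1)) R1 (poly (cost_bound b) X) R' \<and>
      R' (d + 1) = eval M R1 b \<and> (\<forall>r<d + 1. R' r = R1 r)"
    using Plus.prems R1(3) by (intro Plus.IH) force+
  then obtain R2 where R2: "runs M (comp b (d + 1)) R1 (poly (cost_bound b) X) R2"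
      "R2 (d + 1) = eval M R1 b" "\<forall>r<d + 1. R2 r = R1 r" by blast
  have b: "eval M R1 b = eval M R b" using Plus.prems R1(3) by (intro eval_cong) auto
  have "eval M R a \<le> ?A" "eval M R b \<le> ?B"
    using Plus.prems by (auto intro!: eval_le_value_bound)
  then have "runs M (comp (Plus a b) d) R (poly (cost_bound (Plus a b)) X)
      (R2(d := eval M R (Plus a b)))"
    unfolding comp.simps using R1(2) R2(2,3) b
    by (intro runs_mono[OF runs_Seq[OF R1(1) runs_Seq[OF R2(1) runs_Add]]]) simp_all
  moreover have "\<forall>r<d. (R2(d := eval M R (Plus a b))) r = R r" using R1(3) R2(3) by simp
  moreover have "(R2(d := eval M R (Plus a b))) d = eval M R (Plus a b)" by simp
  ultimately show ?case by blast
next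
  case (Minus a b)
  let ?A = "poly (value_bound a) X" and ?B = "poly (value_bound b) X"
  have "\<exists>R'. runs M (comp a d) R (poly (cost_bound a) X) R' \<and> R' d = eval M R a \<and>
      (\<forall>r<d. R' r = R r)"
    using Minus.prems by (intro Minus.IH) auto
  then obtain R1 where R1: "runs M (comp a d) R (poly (cost_bound a) X) R1"
      "R1 d = eval M R a" "\<forall>r<d. R1 r = R r" by blast
  have "\<exists>R'. runs M (comp b (d + 1)) R1 (poly (cost_bound b) X) R' \<and>
      R' (d + 1) = eval M R1 b \<and> (\<forall>r<d + 1. R' r = R1 r)"
    using Minus.prems R1(3) by (intro Minus.IH) force+
  then obtain R2 where R2: "runs M (comp b (d + 1)) R1 (poly (cost_bound b) X) R2"
      "R2 (d + 1) = eval M R1 b" "\<forall>r<d + 1. R2 r = R1 r" by blast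
  have b: "eval M R1 b = eval M R b" using Minus.prems R1(3) by (intro eval_cong) auto
  have "eval M R a \<le> ?A" "eval M R b \<le> ?B"
    using Minus.prems by (auto intro!: eval_le_value_bound)
  then have "runs M (comp (Minus a b) d) R (poly (cost_bound (Minus a b)) X)
      (R2(d := eval M R (Minus a b)))"
    unfolding comp.simps using R1(2) R2(2,3) b
    by (intro runs_mono[OF runs_Seq[OF R1(1) runs_Seq[OF R2(1) runs_Sub]]]) simp_all
  moreover have "\<forall>r<d. (R2(d := eval M R (Minus a b))) r = R r" using R1(3) R2(3) by simp
  moreover have "(R2(d := eval M R (Minus a b))) d = eval M R (Minus a b)" by simp
  ultimately show ?case by blast
next
  case (Mem a)
  let ?A = "poly (value_bound a) X"
  have "\<exists>R'. runs M (comp a d) R (poly (cost_bound a) X) R' \<and> R' d = eval M R a \<and>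
      (\<forall>r<d. R' r = R r)"
    using Mem.prems by (intro Mem.IH) auto
  then obtain R1 where R1: "runs M (comp a d) R (poly (cost_bound a) X) R1"
      "R1 d = eval M R a" "\<forall>r<d. R1 r = R r" by blast
  have "eval M R a \<le> ?A" "M (eval M R a) \<le> X"
    using Mem.prems by (auto intro!: eval_le_value_bound)
  then have "runs M (comp (Mem a) d) R (poly (cost_bound (Mem a)) X) (R1(d := eval M R (Mem a)))"
    unfolding comp.simps using R1(2)
    by (intro runs_mono[OF runs_Seq[OF R1(1) runs_Load]]) simp_all
  moreover have "\<forall>r<d. (R1(d := eval M R (Mem a))) r = R r" using R1(3) by simp
  moreover have "(R1(d := eval M R (Mem a))) d = eval M R (Mem a)" by simp
  ultimately show ?case by blast
next
  case (Sum x a b)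
  define A where "A = poly (value_bound a) X"
  define B where "B = poly (value_bound b) (X + A)"
  define T where "T = poly (cost_bound b) (X + A)"
  define m where "m = eval M R a"
  define f where "f k = eval M (R(x := k)) b" for k
  have x: "x < d" "R x \<le> X" using Sum.prems by auto
  have "\<exists>R'. runs M (comp a d) R (poly (cost_bound a) X) R' \<and> R' d = m \<and>
      (\<forall>r<d. R' r = R r)"
    unfolding m_def using Sum.prems by (intro Sum.IH) auto
  then obtain R1 where R1: "runs M (comp a d) R (poly (cost_bound a) X) R1"
      "R1 d = m" "\<forall>r<d. R1 r = R r" by blast
  have m: "m \<le> A" unfolding m_def A_def using Sum.prems by (auto intro!: eval_le_value_bound)
  have env: "(R(x := k)) y \<le> X + A" if "k < m" "y \<in> vars b" for k y
    using that m Sum.prems(2)[of y] by auto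
  have mem: "M i \<le> X + A" for i using Sum.prems(3)[of i] by simp
  have f: "f k \<le> B" if "k < m" for k
    unfolding f_def B_def using mem env[OF that] by (intro eval_le_value_bound)
  \<comment> \<open>Register \<open>d + 1\<close> saves the outer value of \<open>x\<close>,
    \<open>d + 2\<close> is the accumulator, and \<open>x\<close> starts at the number of
    summands.\<close>
  let ?R2 = "R1(d + 2 := 0, d + 1 := R x, x := m)"
  have 2: "runs M (Const (d + 2) 0) R1 1 (R1(d + 2 := 0))"
    using runs_Const[of M "d + 2" 0 R1] by simp
  have 3: "runs M (Add (d + 1) x (d + 2)) (R1(d + 2 := 0)) (1 + X) (R1(d + 2 := 0, d + 1 := R x))"
    by (rule runs_mono[OF runs_Add]) (use x R1(3) in auto)
  have 4: "runs M (Add x d (d + 2)) (R1(d + 2 := 0, d + 1 := R x)) (1 + A) ?R2"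
    by (rule runs_mono[OF runs_Add]) (use R1(2) m in auto)
  have "\<exists>R'. runs M (While x (Const (d + 2 + 1) 1 ;; Sub x x (d + 2 + 1) ;; comp b (d + 3) ;;
        Add (d + 2) (d + 2) (d + 2 + 1))) ?R2 (m * (6 + m + m + T + B + m * B) + 1) R' \<and>
      R' x = 0 \<and> R' (d + 2) = ?R2 (d + 2) + (\<Sum>k<m. f k) \<and>
      (\<forall>r<d + 2. r \<noteq> x \<longrightarrow> R' r = (R1(d + 1 := R x)) r)"
  \<comment> \<open>Here \<open>s\<close> is \<open>d + 2\<close> and \<open>R0\<close> is
    \<open>R1(d + 1 := R x)\<close>, so the saved value of \<open>x\<close> is among the registers
    that the loop preserves.\<close>
  proof (rule runs_sum_loop)
    fix k R' assume k: "k < m" and R': "\<And>r. r < d + 2 \<Longrightarrow> r \<noteq> x \<Longrightarrow> R' r = (R1(d + 1 := R x)) r"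
      "R' x = k"
    have eq: "R' r = (R(x := k)) r" if "r < d" for r using that R' R1(3) by auto
    have "eval M R' b = f k"
      unfolding f_def using eq Sum.prems(1) by (intro eval_cong) auto
    moreover have "\<exists>R''. runs M (comp b (d + 3)) R' T R'' \<and> R'' (d + 3) = eval M R' b \<and>
        (\<forall>r<d + 3. R'' r = R' r)"
      unfolding T_def
    proof (rule Sum.IH)
      show "R' y \<le> X + A" if "y \<in> vars b" for y
        using eq[of y] env[OF k that] that Sum.prems(1) by auto
    qed (use mem Sum.prems(1) in auto)
    ultimately show "\<exists>R''. runs M (comp b (d + 3)) R' T R'' \<and> R'' (d + 2 + 1) = f k \<and>
        (\<forall>r\<le>d + 2. R'' r = R' r)"
      by (auto simp: numeral_3_eq_3 less_Suc_eq_le)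
  qed (use x f in auto)
  then obtain R3 where R3: "runs M (While x (Const (d + 2 + 1) 1 ;; Sub x x (d + 2 + 1) ;;
        comp b (d + 3) ;; Add (d + 2) (d + 2) (d + 2 + 1))) ?R2
        (m * (6 + m + m + T + B + m * B) + 1) R3"
      "R3 x = 0" "R3 (d + 2) = ?R2 (d + 2) + (\<Sum>k<m. f k)"
      "\<forall>r<d + 2. r \<noteq> x \<longrightarrow> R3 r = (R1(d + 1 := R x)) r"
    by blast
  let ?R4 = "R3(d := \<Sum>k<m. f k)"
  have "(\<Sum>k<m. f k) \<le> A * B"
  proof -
    have "(\<Sum>k<m. f k) \<le> m * B"
      using sum_bounded_above[of "{..<m}" f B] f by simp
    also have "\<dots> \<le> A * B" using m by simp
    finally show ?thesis .
  qed
  then have 6: "runs M (Add d (d + 2) x) R3 (1 + A * B) ?R4"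
    by (intro runs_mono[OF runs_Add]) (use R3(2,3) x in auto)
  have 7: "runs M (Add x (d + 1) x) ?R4 (1 + X) (?R4(x := R x))"
    by (rule runs_mono[OF runs_Add]) (use R3(2,4) x in auto)
  have 5: "runs M (While x (Const (d + 3) 1 ;; Sub x x (d + 3) ;; comp b (d + 3) ;;
        Add (d + 2) (d + 2) (d + 3))) ?R2 (A * (6 + A + A + T + B + A * B) + 1) R3"
  proof -
    have "d + 2 + 1 = d + 3" by simp
    from R3(1)[unfolded this] show ?thesis
      by (rule runs_mono) (use m in \<open>auto intro!: add_mono mult_mono\<close>)
  qed
  have "runs M (comp (Sum x a b) d) R (poly (cost_bound (Sum x a b)) X) (?R4(x := R x))"
    unfolding comp.simps
    using runs_Seq[OF R1(1) runs_Seq[OF 2 runs_Seq[OF 3 runs_Seq[OF 4 runs_Seq[OF 5 runs_Seq[OF 6 7]]]]]]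
    by (rule runs_mono) (simp_all add: poly_pcompose A_def B_def T_def algebra_simps)
  moreover have "(?R4(x := R x)) d = eval M R (Sum x a b)"
    using x by (simp add: m_def f_def)
  moreover have "\<forall>r<d. (?R4(x := R x)) r = R r" using R1(3) R3(4) by auto
  ultimately show ?case by blast
qed


text \<open>The cost bounds are polynomial in the numbers themselves, not in their lengths;
  therefore the memory entries must be bounded by the input size up to a constant.\<close>

lemma polytime_decidableI:
  assumes mem: "\<And>x a. x \<in> I \<Longrightarrow> snd (init (enc x)) a \<le> input_size (enc x) + B"
    and eval: "\<And>x. x \<in> I \<Longrightarrow> P x \<longleftrightarrow> eval (snd (init (enc x))) (\<lambda>_. 0) e \<noteq> 0"
  shows "polytime_decidable I enc P"
proof -
  have "finite (vars e)" by (induction e) auto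
  then obtain d where "\<forall>x\<in>vars e. x < d" using finite_nat_set_iff_bounded by blast
  then have d: "vars e \<subseteq> {..<Suc d}" by auto
  \<comment> \<open>Scratch space starts at \<open>Suc d\<close>, above register 0, which therefore
    is 0 again after the evaluation. Adding it just copies the result to the register of the
    answer.\<close>
  let ?c = "comp e (Suc d) ;; Add 0 (Suc d) 0"
  let ?p = "cost_bound e + value_bound e + 1"
  show ?thesis
    unfolding polytime_decidable_def
  proof (intro exI[of _ ?c] exI[of _ "pcompose ?p [:B, 1:]"] ballI)
    fix x assume x: "x \<in> I"
    define X where "X = input_size (enc x) + B"
    define M where "M = snd (init (enc x))"
    let ?v = "eval M (\<lambda>_. 0) e"
    have M: "M a \<le> X" for a using mem[OF x] by (simp add: M_def X_def)
    obtain R where R: "runs M (comp e (Suc d)) (\<lambda>_. 0) (poly (cost_bound e) X) R"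
        "R (Suc d) = ?v" "R 0 = 0"
      using runs_comp[OF d, of "\<lambda>_. 0" X M] M by auto
    have v: "?v \<le> poly (value_bound e) X" using M by (intro eval_le_value_bound) auto
    have "runs M ?c (\<lambda>_. 0) (poly (pcompose ?p [:B, 1:]) (input_size (enc x))) (R(0 := ?v))"
      using v R(2,3)
      by (intro runs_mono[OF runs_Seq[OF R(1) runs_Add]]) (simp_all add: poly_pcompose X_def add.commute)
    then obtain t where "t \<le> poly (pcompose ?p [:B, 1:]) (input_size (enc x))"
        "exec ?c (init (enc x)) t (R(0 := ?v), M)"
      unfolding runs_def M_def init_def by auto
    then show "\<exists>t R M. exec ?c (init (enc x)) t (R, M) \<and>
        t \<le> poly (pcompose ?p [:B, 1:]) (input_size (enc x)) \<and> (R 0 \<noteq> 0 \<longleftrightarrow> P x)"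
      using eval[OF x] unfolding M_def by (metis fun_upd_same)
  qed
qed

text \<open>Variable 0 is reserved as an idle index.\<close>

definition times :: "exp \<Rightarrow> exp \<Rightarrow> exp" where
  "times a b = Sum 0 a b"

definition neq :: "exp \<Rightarrow> exp \<Rightarrow> exp" where
  "neq a b = Plus (Minus a b) (Minus b a)"

definition is_zero :: "exp \<Rightarrow> exp" where
  "is_zero a = Minus (Num 1) a"

lemma eval_times: "(\<And>k. eval M (R(0 := k)) b = v) \<Longrightarrow> eval M R (times a b) = eval M R a * v"
  by (simp add: times_def)

lemma eval_neq: "eval M R (neq a b) = 0 \<longleftrightarrow> eval M R a = eval M R b"
  by (auto simp: neq_def)

lemma eval_is_zero: "eval M R (is_zero a) = of_bool (eval M R a = 0)"
  by (auto simp: is_zero_def)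

section \<open>Finite tables as expressions\<close>

fun mismatch :: "exp list \<Rightarrow> nat list \<Rightarrow> exp" where
  "mismatch (e # es) (k # ks) = Plus (neq e (Num k)) (mismatch es ks)"
| "mismatch _ _ = Num 0"

text \<open>The values \<open>f k\<close> enter the expression as constants, so \<open>f\<close> may
  be any function, computable or not.\<close>

fun lookup :: "(nat list \<Rightarrow> nat) \<Rightarrow> exp list \<Rightarrow> nat list list \<Rightarrow> exp" where
  "lookup f es [] = Num 0"
| "lookup f es (k # ks) = Plus (times (is_zero (mismatch es k)) (Num (f k))) (lookup f es ks)"

lemma eval_mismatch:
  "length es = length k \<Longrightarrow> eval M R (mismatch es k) = 0 \<longleftrightarrow> map (eval M R) es = k"
  by (induction es k rule: list_induct2) (auto simp: eval_neq)

text \<open>Exactly one key of the table agrees with the numbers read, so a single summand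
  survives.\<close>

lemma eval_lookup:
  assumes "distinct ks" "map (eval M R) es \<in> set ks" "\<And>k. k \<in> set ks \<Longrightarrow> length k = length es"
  shows "eval M R (lookup f es ks) = f (map (eval M R) es)"
proof -
  have "eval M R (lookup f es ks) = (\<Sum>k\<leftarrow>ks. of_bool (map (eval M R) es = k) * f k)"
    using assms(3)
    by (induction ks) (simp_all add: eval_times eval_is_zero eval_mismatch)
  also have "\<dots> = (\<Sum>k\<in>set ks. of_bool (map (eval M R) es = k) * f k)"
    using assms(1) by (rule sum_list_distinct_conv_sum_set)
  also have "\<dots> = (\<Sum>k\<in>set ks. if map (eval M R) es = k then f k else 0)"
    by (intro sum.cong) auto
  also have "\<dots> = f (map (eval M R) es)" using assms(2) by simp
  finally show ?thesis .
qed

section \<open>Optimal manipulations\<close>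

text \<open>
  The admissible outcomes of a game whose teams earn \<open>p\<close> and \<open>q\<close> points in a fair game and belong to
  the coalition according to \<open>c\<close> and \<open>c'\<close>; \<open>f\<close> says whether the team named first is the designated one.
\<close>

definition outcomes ::
  "scoring_model \<Rightarrow> bool \<Rightarrow> rat \<Rightarrow> rat \<Rightarrow> bool \<Rightarrow> bool \<Rightarrow> (rat \<times> rat) set" where
  "outcomes S f p q c c' = {(a, b). (if f then (a, b) else (b, a)) \<in> S \<and>
     (\<not> c \<and> \<not> c' \<longrightarrow> a = p \<and> b = q) \<and> (c \<and> \<not> c' \<longrightarrow> a \<le> p \<and> q \<le> b) \<and>
     (\<not> c \<and> c' \<longrightarrow> p \<le> a \<and> b \<le> q)}"

definition game :: "scoring_model \<Rightarrow> 'a competition \<Rightarrow> 'a set \<Rightarrow> 'a \<Rightarrow> 'a \<Rightarrow> (rat \<times> rat) set" where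
  "game S K C i j = outcomes S (first K i j) (fair K i j) (fair K j i) (i \<in> C) (j \<in> C)"

lemma outcomes_subset: "outcomes S f p q c c' \<subseteq> S \<union> prod.swap ` S"
  unfolding outcomes_def by (force split: if_splits)

lemma finite_game: "scoring_model S \<Longrightarrow> finite (game S K C i j)"
  unfolding game_def scoring_model_def by (rule finite_subset[OF outcomes_subset]) simp

lemma first_swap:
  assumes "round_robin S K" "i \<in> teams K" "j \<in> teams K" "i \<noteq> j"
  shows "first K j i \<longleftrightarrow> \<not> first K i j"
  using assms unfolding round_robin_def by blast

lemma game_swap:
  assumes "round_robin S K" "i \<in> teams K" "j \<in> teams K" "i \<noteq> j" "(a, b) \<in> game S K C i j"
  shows "(b, a) \<in> game S K C j i"
  using assms(5) unfolding game_def outcomes_def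
  by (cases "first K i j") (auto simp: first_swap[OF assms(1-4)])

text \<open>Every game thus has an admissible outcome, so optimal ones exist.\<close>

lemma fair_in_game:
  assumes "round_robin S K" "i \<in> teams K" "j \<in> teams K" "i \<noteq> j"
  shows "(fair K i j, fair K j i) \<in> game S K C i j"
proof (cases "first K i j")
  case True
  with assms have "(fair K i j, fair K j i) \<in> S" unfolding round_robin_def by blast
  with True show ?thesis by (simp add: game_def outcomes_def)
next
  case False
  with assms have "(fair K j i, fair K i j) \<in> S" unfolding round_robin_def by metis
  with False show ?thesis by (simp add: game_def outcomes_def)
qed

text \<open>The constraints bind the two entries of one game and never link different games. For a
  single coalition member they stem from the condition at \<open>(i, j)\<close> or from the one at
  \<open>(j, i)\<close>.\<close>

lemma manipulation_iff:
  assumes "round_robin S K"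
  shows "manipulation S K C u \<longleftrightarrow>
    (\<forall>i\<in>teams K. \<forall>j\<in>teams K. i \<noteq> j \<longrightarrow> (u i j, u j i) \<in> game S K C i j)"
proof
  assume u: "manipulation S K C u"
  show "\<forall>i\<in>teams K. \<forall>j\<in>teams K. i \<noteq> j \<longrightarrow> (u i j, u j i) \<in> game S K C i j"
  proof (intro ballI impI)
    fix i j assume ij: "i \<in> teams K" "j \<in> teams K" "i \<noteq> j"
    from u ij ij(3)[symmetric] show "(u i j, u j i) \<in> game S K C i j"
      unfolding manipulation_def game_def outcomes_def
      by (cases "first K i j") (auto simp: first_swap[OF assms ij])
  qed
next
  assume "\<forall>i\<in>teams K. \<forall>j\<in>teams K. i \<noteq> j \<longrightarrow> (u i j, u j i) \<in> game S K C i j"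
  then show "manipulation S K C u"
    unfolding manipulation_def game_def outcomes_def by (auto split: if_splits)
qed

section \<open>Optimal outcomes of one game\<close>

definition most :: "(rat \<times> rat) set \<Rightarrow> rat \<times> rat" where
  "most = arg_min_on (\<lambda>x. - fst x)"

definition least :: "(rat \<times> rat) set \<Rightarrow> rat \<times> rat" where
  "least = arg_min_on fst"

definition lead :: "(rat \<times> rat) set \<Rightarrow> rat \<times> rat" where
  "lead = arg_min_on (\<lambda>x. snd x - fst x)"

lemma
  assumes "finite A" "x \<in> A"
  shows most_in: "most A \<in> A" and most_ge: "fst x \<le> fst (most A)"
    and least_in: "least A \<in> A" and least_le: "fst (least A) \<le> fst x"
    and lead_in: "lead A \<in> A" and lead_ge: "fst x - snd x \<le> fst (lead A) - snd (lead A)"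
proof -
  have "A \<noteq> {}" using assms(2) by blast
  note in_A = arg_min_if_finite(1)[OF assms(1) this] and le = arg_min_least[OF assms(1) this assms(2)]
  show "most A \<in> A" "least A \<in> A" "lead A \<in> A"
    unfolding most_def least_def lead_def by (rule in_A)+
  show "fst x \<le> fst (most A)" "fst (least A) \<le> fst x"
      "fst x - snd x \<le> fst (lead A) - snd (lead A)"
    using le[of "\<lambda>x. - fst x"] le[of fst] le[of "\<lambda>x. snd x - fst x"]
    unfolding most_def least_def lead_def by linarith+
qed

text \<open>Isolates the one game that counts for both of the scores to be compared.\<close>

lemma score_split:
  assumes "finite (teams K)" "k \<in> teams K" "i \<noteq> k"
  shows "score K u i = (\<Sum>j\<in>teams K - {i, k}. u i j) + u i k"
proof -
  have "teams K - {i} = insert k (teams K - {i, k})" using assms by auto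
  with assms show ?thesis by (simp add: score_def add.commute)
qed

lemma destructive_manipulation_iff:
  assumes S: "scoring_model S" and K: "round_robin S K" and l: "l \<in> teams K"
  shows "destructive_manipulation S K C l \<longleftrightarrow> (\<exists>i\<in>teams K. i \<noteq> l \<and>
    (\<Sum>j\<in>teams K - {i, l}. fst (least (game S K C l j))) + snd (lead (game S K C i l)) <
    (\<Sum>j\<in>teams K - {i, l}. fst (most (game S K C i j))) + fst (lead (game S K C i l)))"
    (is "_ \<longleftrightarrow> (\<exists>i\<in>_. _ \<and> ?loss i < ?gain i)")
proof
  have fin: "finite (teams K)" using K by (simp add: round_robin_def)
  note G = finite_game[OF S, of K C]
  assume "destructive_manipulation S K C l"
  then obtain u i where u: "manipulation S K C u" and i: "i \<in> teams K" "i \<noteq> l"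
      and less: "score K u l < score K u i"
    unfolding destructive_manipulation_def loses_def by blast
  have ug: "(u x y, u y x) \<in> game S K C x y" if "x \<in> teams K" "y \<in> teams K" "x \<noteq> y" for x y
    using u that unfolding manipulation_iff[OF K] by blast
  have "(\<Sum>j\<in>teams K - {i, l}. u i j) \<le> (\<Sum>j\<in>teams K - {i, l}. fst (most (game S K C i j)))"
    using most_ge[OF G ug] i by (intro sum_mono) auto
  moreover have "(\<Sum>j\<in>teams K - {i, l}. fst (least (game S K C l j))) \<le> (\<Sum>j\<in>teams K - {i, l}. u l j)"
    using least_le[OF G ug] l by (intro sum_mono) auto
  \<comment> \<open>This game contributes to both scores, so only the difference of its entries can
    be bounded.\<close>
  moreover have "u i l - u l i \<le> fst (lead (game S K C i l)) - snd (lead (game S K C i l))"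
    using lead_ge[OF G ug[OF i(1) l i(2)]] by simp
  ultimately have "?loss i < ?gain i"
    using less score_split[OF fin l i(2), of u]
      score_split[OF fin i(1) not_sym[OF i(2)], of u, unfolded insert_commute[of l i]]
    by linarith
  with i show "\<exists>i\<in>teams K. i \<noteq> l \<and> ?loss i < ?gain i" by (intro bexI conjI)
next
  have fin: "finite (teams K)" using K by (simp add: round_robin_def)
  note G = finite_game[OF S, of K C]
  assume "\<exists>i\<in>teams K. i \<noteq> l \<and> ?loss i < ?gain i"
  then obtain i where i: "i \<in> teams K" "i \<noteq> l" and less: "?loss i < ?gain i"
    by (elim bexE conjE)
  \<comment> \<open>Orients every game: \<open>i\<close> comes before all others, \<open>l\<close>
    before all but \<open>i\<close>, and the rest follow \<open>first\<close>. Since exactly one of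
    two distinct teams comes before the other, \<open>u x y\<close> and \<open>u y x\<close> are
    read off the same outcome \<open>w\<close>.\<close>
  define before where "before x y \<longleftrightarrow>
    x = i \<or> x = l \<and> y \<noteq> i \<or> y \<noteq> i \<and> y \<noteq> l \<and> first K x y" for x y
  define w where "w x y = (if x = i then if y = l then lead (game S K C i l) else most (game S K C i y)
    else if x = l then least (game S K C l y) else (fair K x y, fair K y x))" for x y
  define u where "u x y = (if before x y then fst (w x y) else snd (w y x))" for x y
  have before: "before x y \<longleftrightarrow> \<not> before y x" if "x \<in> teams K" "y \<in> teams K" "x \<noteq> y" for x y
    using first_swap[OF K that] that(3) i(2) unfolding before_def by blast
  have w: "w x y \<in> game S K C x y" if "x \<in> teams K" "y \<in> teams K" "x \<noteq> y" for x y
  proof -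
    note fair = fair_in_game[OF K that, of C]
    show ?thesis
      using most_in[OF G fair] least_in[OF G fair] lead_in[OF G fair] fair by (auto simp: w_def)
  qed
  have "(u x y, u y x) \<in> game S K C x y" if xy: "x \<in> teams K" "y \<in> teams K" "x \<noteq> y" for x y
  proof (cases "before x y")
    case True
    then show ?thesis using before[OF xy] w[OF xy] by (simp add: u_def)
  next
    case False
    then have "(u y x, u x y) \<in> game S K C y x"
      using before[OF xy] w[OF xy(2,1)] xy(3) by (simp add: u_def)
    then show ?thesis using game_swap[OF K xy(2,1)] xy(3) by blast
  qed
  then have "manipulation S K C u" by (simp add: manipulation_iff[OF K])
  moreover have "score K u i = ?gain i"
    using i by (simp add: score_split[OF fin l] u_def before_def w_def)
  moreover have "score K u l = ?loss i"
    using i by (simp add: score_split[OF fin i(1)] u_def before_def w_def insert_commute[of l i])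
  ultimately show "destructive_manipulation S K C l"
    using i less unfolding destructive_manipulation_def loses_def by metis
qed


section \<open>Reading an instance\<close>

lemma length_concat_map:
  "(\<And>i. length (f i) = m) \<Longrightarrow> length (concat (map f [0..<n])) = n * m"
  by (induction n) simp_all

lemma nth_concat_map:
  assumes "\<And>i. length (f i) = m" "i < n" "k < m"
  shows "concat (map f [0..<n]) ! (i * m + k) = f i ! k"
  using assms(2)
proof (induction n)
  case (Suc n)
  have len: "length (concat (map f [0..<n])) = n * m"
    using assms(1) by (rule length_concat_map)
  show ?case
  proof (cases "i < n")
    case True
    then have "Suc i * m \<le> n * m" by (intro mult_le_mono1) simp
    with assms(3) have "i * m + k < n * m" by simp
    with Suc.IH[OF True] len show ?thesis by (simp add: nth_append)
  next
    case False
    with Suc.prems have "i = n" by simp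
    with len show ?thesis by (simp add: nth_append)
  qed
qed simp

definition memory :: "instance_data \<Rightarrow> nat \<Rightarrow> nat" where
  "memory x = snd (init (encode x))"

context
  fixes K :: "nat competition" and C :: "nat set" and l n :: nat
  assumes teams: "teams K = {..<n}"
begin

lemma length_encode_game: "length (encode_game K i j) = 3"
  by (simp add: encode_game_def encode_rat_def)

lemma length_encode_row: "length (concat (map (encode_game K i) [0..<m])) = m * 3"
  by (intro length_concat_map length_encode_game)

lemma encode_eq:
  "encode (K, C, l) = [n, l] @ map (\<lambda>i. of_bool (i \<in> C)) [0..<n] @
     concat (map (\<lambda>i. concat (map (encode_game K i) [0..<n])) [0..<n])"
  by (simp add: teams Let_def)

lemma length_encode: "length (encode (K, C, l)) = 2 + n + n * (n * 3)"
  unfolding encode_eq by (simp add: length_concat_map[OF length_encode_row])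

lemma memory_teams: "memory (K, C, l) 0 = n" "memory (K, C, l) 1 = l"
  unfolding memory_def init_def length_encode snd_conv by (simp_all add: teams Let_def)

lemma memory_coalition:
  assumes "i < n"
  shows "memory (K, C, l) (2 + i) = of_bool (i \<in> C)"
  unfolding memory_def init_def length_encode snd_conv using assms by (simp add: teams Let_def nth_append)

text \<open>The header has length \<open>2 + n\<close>, a row \<open>n * 3\<close> and an entry 3.
  The address has the shape that evaluating \<open>entry\<close> produces.\<close>

lemma memory_game:
  assumes "i < n" "j < n" "k < 3"
  shows "memory (K, C, l) (2 + k + (n + 3 * (i * n + j))) = encode_game K i j ! k"
proof -
  have k: "j * 3 + k < n * 3" using assms by simp
  \<comment> \<open>The address must lie within the input, since \<open>init\<close> puts 0 beyond
    it.\<close>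
  have "i * (n * 3) + (j * 3 + k) < Suc i * (n * 3)" using k by simp
  also have "\<dots> \<le> n * (n * 3)" using assms(1) by (intro mult_le_mono1) simp
  finally have less: "i * (n * 3) + (j * 3 + k) < n * (n * 3)" .
  have addr: "2 + k + (n + 3 * (i * n + j)) = 2 + n + (i * (n * 3) + (j * 3 + k))"
    by (simp add: algebra_simps)
  have "memory (K, C, l) (2 + k + (n + 3 * (i * n + j))) =
      concat (map (\<lambda>i. concat (map (encode_game K i) [0..<n])) [0..<n]) ! (i * (n * 3) + (j * 3 + k))"
    unfolding addr memory_def init_def length_encode snd_conv using less
    by (simp add: teams Let_def nth_append)
  also have "\<dots> = encode_game K i j ! k"
    using nth_concat_map[OF length_encode_row assms(1) k]
      nth_concat_map[OF length_encode_game assms(2,3)] by simp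
  finally show ?thesis .
qed

end

lemma memory_le:
  assumes "\<And>a. a \<in> set (encode x) \<Longrightarrow> a \<le> B"
  shows "memory x a \<le> B"
  using assms by (auto simp: memory_def init_def)

section \<open>Keys: input patterns of one game\<close>

definition key :: "nat competition \<Rightarrow> nat set \<Rightarrow> nat \<Rightarrow> nat \<Rightarrow> nat list" where
  "key K C i j = [of_bool (first K i j)] @ encode_rat (fair K i j) @ encode_rat (fair K j i) @
     [of_bool (i \<in> C), of_bool (j \<in> C)]"

definition decode_rat :: "nat \<Rightarrow> nat \<Rightarrow> rat" where
  "decode_rat a b = of_nat a / of_nat b"

lemma decode_rat: "0 \<le> q \<Longrightarrow> encode_rat q = [a, b] \<Longrightarrow> decode_rat a b = q"
  by (cases "quotient_of q")
    (use quotient_of_div[of q] quotient_of_denom_pos[of q] in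
      \<open>auto simp: encode_rat_def decode_rat_def zero_le_divide_iff\<close>)

definition game_of_key :: "scoring_model \<Rightarrow> nat list \<Rightarrow> (rat \<times> rat) set" where
  "game_of_key S k = outcomes S (k ! 0 \<noteq> 0) (decode_rat (k ! 1) (k ! 2)) (decode_rat (k ! 3) (k ! 4))
     (k ! 5 \<noteq> 0) (k ! 6 \<noteq> 0)"

text \<open>Besides \<open>S\<close>, the admissible outcomes depend on the key alone, and so do the
  optimal ones.\<close>

lemma game_of_key:
  assumes "0 \<le> fair K i j" "0 \<le> fair K j i"
  shows "game_of_key S (key K C i j) = game S K C i j"
proof -
  obtain a b a' b' where e: "encode_rat (fair K i j) = [a, b]" "encode_rat (fair K j i) = [a', b']"
    by (simp add: encode_rat_def)
  show ?thesis
    unfolding game_of_key_def key_def e game_def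
    using decode_rat[OF assms(1) e(1)] decode_rat[OF assms(2) e(2)] by simp
qed

text \<open>
  In multiples of \<open>1 / D\<close>; the rounding is vacuous when \<open>D\<close> is a common denominator of \<open>S\<close>.
\<close>

definition points ::
  "nat \<Rightarrow> scoring_model \<Rightarrow> ((rat \<times> rat) set \<Rightarrow> rat) \<Rightarrow> nat list \<Rightarrow> nat" where
  "points D S \<phi> k = nat \<lfloor>of_nat D * \<phi> (game_of_key S k)\<rfloor>"

text \<open>Take the product of the denominators; as the numerators are non-negative,
  \<open>nat\<close> and the floor lose nothing.\<close>

lemma common_denominator:
  assumes "finite A" "\<And>q. q \<in> A \<Longrightarrow> 0 \<le> q"
  obtains D where "0 < D" "\<And>q :: rat. q \<in> A \<Longrightarrow> of_nat (nat \<lfloor>of_nat D * q\<rfloor>) = of_nat D * q"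
proof -
  from assms have "\<exists>D>0. \<forall>q\<in>A. \<exists>m. of_nat D * q = of_nat m"
  proof (induction A rule: finite_induct)
    case (insert q A)
    then obtain D where D: "0 < D" "\<forall>q\<in>A. \<exists>m. of_nat D * q = of_nat m" by auto
    obtain a b where ab: "quotient_of q = (a, b)" by (cases "quotient_of q")
    then have b: "0 < b" and q: "q = of_int a / of_int b"
      by (simp_all add: quotient_of_denom_pos quotient_of_div)
    from insert.prems[of q] b q have "0 \<le> a" by (simp add: zero_le_divide_iff)
    have "of_nat (D * nat b) * q = of_nat (D * nat a)"
      using b \<open>0 \<le> a\<close> by (simp add: q)
    moreover have "\<exists>m. of_nat (D * nat b) * p = of_nat m" if "p \<in> A" for p
    proof -
      from D(2) that obtain m where "of_nat D * p = of_nat m" by blast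
      then have "of_nat (D * nat b) * p = of_nat (nat b * m)" by (simp add: ac_simps)
      then show ?thesis by blast
    qed
    moreover have "0 < D * nat b" using D(1) b by simp
    ultimately show ?case by blast
  qed auto
  then obtain D where D: "0 < D" "\<forall>q\<in>A. \<exists>m. of_nat D * q = of_nat m" by blast
  have "of_nat (nat \<lfloor>of_nat D * q\<rfloor>) = of_nat D * q" if "q \<in> A" for q
  proof -
    from D(2) that obtain m where "of_nat D * q = of_nat m" by blast
    then show ?thesis by simp
  qed
  with D(1) that show ?thesis by blast
qed

section \<open>The decision procedure\<close>

definition team_count :: exp where
  "team_count = Mem (Num 0)"

definition target :: exp where
  "target = Mem (Num 1)"

definition entry :: "nat \<Rightarrow> exp \<Rightarrow> exp \<Rightarrow> exp" where
  "entry k x y =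
     Mem (Plus (Num (2 + k)) (Plus team_count (times (Num 3) (Plus (times x team_count) y))))"

text \<open>In the order of \<open>key\<close>: designation, numerator and denominator of either
  team's fair points, and the two coalition bits, which are stored from address 2 on.\<close>

definition key_exp :: "exp \<Rightarrow> exp \<Rightarrow> exp list" where
  "key_exp x y = [entry 0 x y, entry 1 x y, entry 2 x y, entry 1 y x, entry 2 y x,
     Mem (Plus (Num 2) x), Mem (Plus (Num 2) y)]"

text \<open>Variable 1 holds the rival and variable 2 runs through the opponents.\<close>

definition sum_others :: "exp \<Rightarrow> exp" where
  "sum_others e = Sum 2 team_count (times
     (is_zero (Plus (is_zero (neq (Var 2) (Var 1))) (is_zero (neq (Var 2) target)))) e)"

lemma vars_target: "vars target = {}"
  by (simp add: target_def)

text \<open>\<open>times\<close> rebinds variable 0 in its second factor, so \<open>x\<close> and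
  \<open>y\<close> must avoid it.\<close>

lemma eval_entry:
  assumes "0 \<notin> vars x" "0 \<notin> vars y"
  shows "eval M R (entry k x y) = M (2 + k + (M 0 + 3 * (eval M R x * M 0 + eval M R y)))"
proof -
  have "eval M (R(0 := i)) x = eval M R x" "eval M (R(0 := i)) y = eval M R y" for i R
    using assms by (auto intro!: eval_cong)
  then show ?thesis by (simp add: entry_def team_count_def times_def)
qed

text \<open>The guard is 0 or 1, so the underlying sum has at most the summand with index 0.\<close>

lemma eval_guarded:
  "eval M R (times (is_zero g) e) = (if eval M R g = 0 then eval M (R(0 := 0)) e else 0)"
  by (simp add: times_def is_zero_def)

text \<open>Data hardwired into the program, depending only on \<open>S\<close>. \<open>B\<close>
  bounds the encoded points and the Boolean entries, and \<open>ks\<close> lists all candidate keys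
  over \<open>{..B}\<close>.\<close>

locale tabulated_model =
  fixes S :: scoring_model and B D :: nat and ks :: "nat list list"
  assumes model: "scoring_model S"
    and rat_le: "q \<in> fst ` S \<union> snd ` S \<Longrightarrow> set (encode_rat q) \<subseteq> {..B}" "1 \<le> B"
    and D: "0 < D" "q \<in> fst ` S \<union> snd ` S \<Longrightarrow> of_nat (nat \<lfloor>of_nat D * q\<rfloor>) = of_nat D * q"
    and keys: "distinct ks" "set ks = {k. set k \<subseteq> {..B} \<and> length k = 7}"
begin

definition table :: "((rat \<times> rat) set \<Rightarrow> rat) \<Rightarrow> exp \<Rightarrow> exp \<Rightarrow> exp" where
  "table \<phi> x y = lookup (points D S \<phi>) (key_exp x y) ks"

text \<open>\<open>gain\<close> and \<open>loss\<close> are the two sides of the inequality in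
  \<open>destructive_manipulation_iff\<close>, scaled by \<open>D\<close>, for the rival in variable
  1.\<close>

definition gain :: exp where
  "gain = Plus (sum_others (table (\<lambda>A. fst (most A)) (Var 1) (Var 2)))
     (table (\<lambda>A. fst (lead A)) (Var 1) target)"

definition loss :: exp where
  "loss = Plus (sum_others (table (\<lambda>A. fst (least A)) target (Var 2)))
     (table (\<lambda>A. snd (lead A)) (Var 1) target)"

text \<open>Truncated subtraction is positive exactly when \<open>gain\<close> exceeds
  \<open>loss\<close>, so the sum acts as an existential quantifier over rivals. The double
  \<open>is_zero\<close> turns the inequality of teams into a factor 0 or 1.\<close>

definition decide :: exp where
  "decide = Sum 1 team_count
     (times (is_zero (is_zero (neq (Var 1) target))) (Minus gain loss))"

end

section \<open>Correctness on a single instance\<close>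

locale tabulated_instance = tabulated_model +
  fixes K :: "nat competition" and C :: "nat set" and l n :: nat
  assumes robin: "round_robin S K" and teams: "teams K = {..<n}" and l: "l < n"
begin

abbreviation M :: "nat \<Rightarrow> nat" where
  "M \<equiv> memory (K, C, l)"

lemma eval_team_count: "eval M R team_count = n"
  by (simp add: team_count_def memory_teams[OF teams])

lemma eval_target: "eval M R target = l"
  using memory_teams(2)[OF teams] by (simp add: target_def)

lemma eval_coalition: "eval M R x < n \<Longrightarrow> eval M R (Mem (Plus (Num 2) x)) = of_bool (eval M R x \<in> C)"
  unfolding eval.simps by (rule memory_coalition[OF teams])

lemma eval_entry_game:
  assumes "0 \<notin> vars x" "eval M R x < n" "0 \<notin> vars y" "eval M R y < n" "k < 3"
  shows "eval M R (entry k x y) = encode_game K (eval M R x) (eval M R y) ! k"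
  unfolding eval_entry[OF assms(1,3)] memory_teams(1)[OF teams]
  by (rule memory_game[OF teams assms(2,4,5)])

text \<open>Admissible outcomes lie in \<open>S\<close> up to swapping, so scaling them by
  \<open>D\<close> is exact.\<close>

lemma
  assumes "i < n" "j < n" "i \<noteq> j"
  shows fair_in: "fair K i j \<in> fst ` S \<union> snd ` S"
    and most_in_model: "fst (most (game S K C i j)) \<in> fst ` S \<union> snd ` S"
    and least_in_model: "fst (least (game S K C i j)) \<in> fst ` S \<union> snd ` S"
    and lead_in_model: "fst (lead (game S K C i j)) \<in> fst ` S \<union> snd ` S"
      "snd (lead (game S K C i j)) \<in> fst ` S \<union> snd ` S"
proof -
  have "i \<in> teams K" "j \<in> teams K" using assms teams by auto
  note fair = fair_in_game[OF robin this assms(3), of C]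
  note fin = finite_game[OF model, of K C i j]
  have sub: "fst x \<in> fst ` S \<union> snd ` S" "snd x \<in> fst ` S \<union> snd ` S" if "x \<in> game S K C i j" for x
  proof -
    have "x \<in> S \<union> prod.swap ` S" using that outcomes_subset unfolding game_def by blast
    then show "fst x \<in> fst ` S \<union> snd ` S" "snd x \<in> fst ` S \<union> snd ` S" by force+
  qed
  show "fair K i j \<in> fst ` S \<union> snd ` S" using sub(1)[OF fair] by simp
  show "fst (most (game S K C i j)) \<in> fst ` S \<union> snd ` S"
    using most_in[OF fin fair] by (rule sub(1))
  show "fst (least (game S K C i j)) \<in> fst ` S \<union> snd ` S"
    using least_in[OF fin fair] by (rule sub(1))
  show "fst (lead (game S K C i j)) \<in> fst ` S \<union> snd ` S"
    "snd (lead (game S K C i j)) \<in> fst ` S \<union> snd ` S"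
    using lead_in[OF fin fair] by (rule sub)+
qed

text \<open>The expressions read off the key of the game, and the table stores the exact scaled
  points for it. The teams are distinct, so no zero entry of the diagonal is read.\<close>

lemma eval_table:
  assumes ij: "i < n" "j < n" "i \<noteq> j" and x: "0 \<notin> vars x" "eval M R x = i"
    and y: "0 \<notin> vars y" "eval M R y = j" and \<phi>: "\<phi> (game S K C i j) \<in> fst ` S \<union> snd ` S"
  shows "of_nat (eval M R (table \<phi> x y)) = of_nat D * \<phi> (game S K C i j)"
proof -
  have key: "map (eval M R) (key_exp x y) = key K C i j"
    using ij x y unfolding key_exp_def
    by (simp add: eval_entry_game eval_coalition encode_game_def encode_rat_def key_def
        del: eval.simps)
  have "set (encode_rat (fair K i j)) \<subseteq> {..B}" "set (encode_rat (fair K j i)) \<subseteq> {..B}"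
    using rat_le(1) fair_in ij by metis+
  with rat_le(2) have "key K C i j \<in> set ks"
    unfolding keys(2) key_def by (auto simp: encode_rat_def)
  then have "eval M R (table \<phi> x y) = points D S \<phi> (key K C i j)"
    unfolding table_def using key keys by (subst eval_lookup) (auto simp: key_exp_def)
  moreover have "game_of_key S (key K C i j) = game S K C i j"
  proof (rule game_of_key)
    have "0 \<le> q" if "q \<in> fst ` S \<union> snd ` S" for q
      using that model unfolding scoring_model_def by auto
    then show "0 \<le> fair K i j" "0 \<le> fair K j i" using fair_in ij by metis+
  qed
  ultimately show ?thesis using D(2)[OF \<phi>] by (simp add: points_def)
qed

lemma eval_sum_others:
  assumes "R 1 = i"
  shows "eval M R (sum_others e) = (\<Sum>j\<in>{..<n} - {i, l}. eval M (R(2 := j, 0 := 0)) e)"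
proof -
  have "eval M R (sum_others e) = (\<Sum>j<n. if j \<noteq> i \<and> j \<noteq> l then eval M (R(2 := j, 0 := 0)) e else 0)"
    unfolding sum_others_def eval.simps
    using assms by (intro sum.cong)
      (auto simp: eval_guarded eval_is_zero eval_neq eval_team_count eval_target)
  also have "\<dots> = (\<Sum>j\<in>{..<n} - {i, l}. eval M (R(2 := j, 0 := 0)) e)"
    by (intro sum.mono_neutral_cong_right) auto
  finally show ?thesis .
qed

lemma eval_gain:
  assumes "i < n" "i \<noteq> l" "R 1 = i"
  shows "of_nat (eval M R gain) = of_nat D *
    ((\<Sum>j\<in>{..<n} - {i, l}. fst (most (game S K C i j))) + fst (lead (game S K C i l)))"
proof -
  have "of_nat (eval M (R(2 := j, 0 := 0)) (table (\<lambda>A. fst (most A)) (Var 1) (Var 2))) =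
      of_nat D * fst (most (game S K C i j))" if "j \<in> {..<n} - {i, l}" for j
    using assms that most_in_model[of i j] by (intro eval_table) auto
  moreover have "of_nat (eval M R (table (\<lambda>A. fst (lead A)) (Var 1) target)) =
      of_nat D * fst (lead (game S K C i l))"
    using assms l lead_in_model(1)[of i l] by (intro eval_table) (auto simp: eval_target vars_target)
  ultimately show ?thesis
    by (simp add: gain_def eval_sum_others[of R i, OF assms(3)] sum_distrib_left distrib_left)
qed

lemma eval_loss:
  assumes "i < n" "i \<noteq> l" "R 1 = i"
  shows "of_nat (eval M R loss) = of_nat D *
    ((\<Sum>j\<in>{..<n} - {i, l}. fst (least (game S K C l j))) + snd (lead (game S K C i l)))"
proof -
  have "of_nat (eval M (R(2 := j, 0 := 0)) (table (\<lambda>A. fst (least A)) target (Var 2))) =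
      of_nat D * fst (least (game S K C l j))" if "j \<in> {..<n} - {i, l}" for j
    using assms l that least_in_model[of l j]
    by (intro eval_table) (auto simp: eval_target vars_target)
  moreover have "of_nat (eval M R (table (\<lambda>A. snd (lead A)) (Var 1) target)) =
      of_nat D * snd (lead (game S K C i l))"
    using assms l lead_in_model(2)[of i l] by (intro eval_table) (auto simp: eval_target vars_target)
  ultimately show ?thesis
    by (simp add: loss_def eval_sum_others[of R i, OF assms(3)] sum_distrib_left distrib_left)
qed

lemma eval_decide: "eval M (\<lambda>_. 0) decide \<noteq> 0 \<longleftrightarrow> destructive_manipulation S K C l"
proof -
  \<comment> \<open>The registers inside the sum over rivals: variable 1 is bound to
    \<open>i\<close>, variable 0 to 0 by the guard.\<close>
  let ?R = "\<lambda>i. (\<lambda>_ :: nat. 0)(1 := i, 0 := 0 :: nat)"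
  have less: "eval M (?R i) loss < eval M (?R i) gain \<longleftrightarrow>
      (\<Sum>j\<in>{..<n} - {i, l}. fst (least (game S K C l j))) + snd (lead (game S K C i l)) <
      (\<Sum>j\<in>{..<n} - {i, l}. fst (most (game S K C i j))) + fst (lead (game S K C i l))"
    if "i < n" "i \<noteq> l" for i
  proof -
    have "?R i 1 = i" by simp
    note g = eval_gain[of i "?R i", OF that this] and l = eval_loss[of i "?R i", OF that this]
    have "eval M (?R i) loss < eval M (?R i) gain \<longleftrightarrow>
        (of_nat (eval M (?R i) loss) :: rat) < of_nat (eval M (?R i) gain)"
      by (simp only: of_nat_less_iff)
    also have "\<dots> \<longleftrightarrow> (\<Sum>j\<in>{..<n} - {i, l}. fst (least (game S K C l j))) + snd (lead (game S K C i l)) <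
      (\<Sum>j\<in>{..<n} - {i, l}. fst (most (game S K C i j))) + fst (lead (game S K C i l))"
      unfolding g l using D(1) by (intro mult_less_cancel_left_pos) simp
    finally show ?thesis .
  qed
  have "eval M (\<lambda>_. 0) decide =
      (\<Sum>i<n. if i \<noteq> l then eval M (?R i) gain - eval M (?R i) loss else 0)"
    unfolding decide_def eval.simps
    by (intro sum.cong) (auto simp: eval_guarded eval_is_zero eval_neq eval_team_count eval_target)
  then have "eval M (\<lambda>_. 0) decide \<noteq> 0 \<longleftrightarrow>
      (\<exists>i\<in>{..<n}. i \<noteq> l \<and> eval M (?R i) loss < eval M (?R i) gain)"
    by (auto simp: Bex_def)
  also have "\<dots> \<longleftrightarrow> destructive_manipulation S K C l"
  proof -
    have "l \<in> teams K" using l teams by simp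
    show ?thesis
      unfolding destructive_manipulation_iff[OF model robin \<open>l \<in> teams K\<close>] teams
      by (intro bex_cong conj_cong refl less) auto
  qed
  finally show ?thesis .
qed

text \<open>Only \<open>n\<close> and \<open>l\<close> can exceed \<open>B\<close>, and both are at
  most the length of the input.\<close>

lemma memory_bound: "M a \<le> input_size (encode (K, C, l)) + B"
proof -
  have "length xs \<le> input_size xs" for xs
    by (induction xs) (auto simp: input_size_def)
  then have n: "n \<le> input_size (encode (K, C, l))"
    using length_encode[OF teams] by (metis add.commute le_add1 le_trans add.assoc)
  have "x \<le> B" if "x \<in> set (encode_game K i j)" "i < n" "j < n" for x i j
  proof (cases "i = j")
    case False
    then show ?thesis
      using that rat_le(1)[OF fair_in[of i j]] rat_le(2) by (auto simp: encode_game_def split: if_splits)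
  qed (use that in \<open>simp add: encode_game_def\<close>)
  then have "x \<le> n \<or> x \<le> B" if "x \<in> set (encode (K, C, l))" for x
    using that rat_le(2) l unfolding encode_eq[OF teams] by fastforce
  then show ?thesis using n by (intro memory_le) (meson le_trans trans_le_add1 trans_le_add2)
qed

end

lemma tabulated_model_exists:
  assumes "scoring_model S"
  obtains B D ks where "tabulated_model S B D ks"
proof -
  let ?A = "fst ` S \<union> snd ` S"
  have fin: "finite ?A" using assms by (simp add: scoring_model_def)
  have nonneg: "0 \<le> q" if "q \<in> ?A" for q
    using that assms unfolding scoring_model_def by auto
  obtain D where D: "0 < D" "\<And>q. q \<in> ?A \<Longrightarrow> of_nat (nat \<lfloor>of_nat D * q\<rfloor>) = of_nat D * q"
    using common_denominator[OF fin nonneg] by blast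
  have "finite (insert 1 (\<Union>q\<in>?A. set (encode_rat q)))"
    by (intro finite.insertI finite_UN_I fin finite_set)
  then obtain B where B: "insert 1 (\<Union>q\<in>?A. set (encode_rat q)) \<subseteq> {..B}"
    unfolding finite_nat_set_iff_bounded_le by blast
  obtain ks where "distinct ks" "set ks = {k. set k \<subseteq> {..B} \<and> length k = 7}"
    using finite_distinct_list[OF finite_lists_length_eq[of "{..B}" 7]] by blast
  then have "tabulated_model S B D ks" using assms B D by unfold_locales auto
  then show thesis by (rule that)
qed

theorem theorem4:
  fixes S :: scoring_model
  assumes "scoring_model S"
  shows "polytime_decidable (instances S) encode
           (\<lambda>(K, C, l). destructive_manipulation S K C l)"
proof -
  \<comment> \<open>Chosen before any instance is given, so the one expression \<open>decide\<close>
    serves them all.\<close>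
  obtain B D ks where "tabulated_model S B D ks" using tabulated_model_exists[OF assms] .
  then interpret tabulated_model S B D ks .
  have inst: "tabulated_instance S B D ks K l (card (teams K))" if "(K, C, l) \<in> instances S" for K C l
    using that by unfold_locales (auto simp: instances_def)
  show ?thesis
  proof (rule polytime_decidableI)
    fix x a assume "x \<in> instances S"
    then show "snd (init (encode x)) a \<le> input_size (encode x) + B"
      using tabulated_instance.memory_bound[OF inst] unfolding memory_def by (cases x) blast
  next
    fix x assume "x \<in> instances S"
    then show "(case x of (K, C, l) \<Rightarrow> destructive_manipulation S K C l) \<longleftrightarrow>
        eval (snd (init (encode x))) (\<lambda>_. 0) decide \<noteq> 0"
      using tabulated_instance.eval_decide[OF inst] unfolding memory_def
      by (cases x) (simp del: encode.simps)
  qed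
qed

end
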